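(* Let $f:\mathbb{R}^2\to\mathbb{R}$ be a function of class $C^3$ such that the entire gradient graph $\{(x,y,f_x(x,y),f_y(x,y)):(x,y)\in\mathbb{R}^2\}$ is a maximal surface in $\mathbb{R}^4_2$. Then this graph is a spacelike plane.
   Context: $\mathbb{R}^4_2$ is $\mathbb{R}^4$ with the pseudo-Euclidean metric $dx_1^2+dx_2^2-dx_3^2-dx_4^2$. A maximal surface in $\mathbb{R}^4_2$ is a spacelike surface (the induced metric is positive definite) of zero mean curvature. For a graph $(x,y,g_1(x,y),g_2(x,y))$, with $\widehat{E}=1-\sum_k(\partial_x g_k)^2$, $\widehat{F}=-\sum_k\partial_x g_k\,\partial_y g_k$, $\widehat{G}=1-\sum_k(\partial_y g_k)^2$, being maximal means that the metric $\widehat{E}dx^2+2\widehat{F}dxdy+\widehat{G}dy^2$ is positive definite and $\widehat{G}\,\partial_{xx}g_k-2\widehat{F}\,\partial_{xy}g_k+\widehat{E}\,\partial_{yy}g_k=0$ for $k=1,2$. *)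

theory Defs
  imports "HOL-Analysis.Analysis"
begin

text \<open>Since every directional derivative has to be of class \<open>C\<^sup>k\<close>, on a finite-dimensional
  domain this is the usual class \<open>C\<^sup>k\<^sup>+\<^sup>1\<close> (the derivative depends linearly on the direction).\<close>

primrec C_k :: "nat \<Rightarrow> ('a::euclidean_space \<Rightarrow> 'b::real_normed_vector) \<Rightarrow> bool" where
  "C_k 0 f \<longleftrightarrow> continuous_on UNIV f"
| "C_k (Suc k) f \<longleftrightarrow>
     (\<forall>p. f differentiable (at p)) \<and> (\<forall>v. C_k k (\<lambda>p. frechet_derivative f (at p) v))"

definition partial_x :: "(real \<times> real \<Rightarrow> real) \<Rightarrow> real \<times> real \<Rightarrow> real" where
  "partial_x g = (\<lambda>(x, y). deriv (\<lambda>t. g (t, y)) x)"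

definition partial_y :: "(real \<times> real \<Rightarrow> real) \<Rightarrow> real \<times> real \<Rightarrow> real" where
  "partial_y g = (\<lambda>(x, y). deriv (\<lambda>t. g (x, t)) y)"

type_synonym r4 = "real \<times> real \<times> real \<times> real"

text \<open>The polarized form of \<open>dx\<^sub>1\<^sup>2 + dx\<^sub>2\<^sup>2 - dx\<^sub>3\<^sup>2 - dx\<^sub>4\<^sup>2\<close>.\<close>

definition form42 :: "r4 \<Rightarrow> r4 \<Rightarrow> real" where
  "form42 = (\<lambda>(a1, a2, a3, a4) (b1, b2, b3, b4). a1 * b1 + a2 * b2 - a3 * b3 - a4 * b4)"

definition graph42 :: "(real \<times> real \<Rightarrow> real) \<Rightarrow> (real \<times> real \<Rightarrow> real) \<Rightarrow> r4 set" where
  "graph42 g1 g2 = {(x, y, g1 (x, y), g2 (x, y)) | x y. True}"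

definition E_hat :: "(real \<times> real \<Rightarrow> real) \<Rightarrow> (real \<times> real \<Rightarrow> real) \<Rightarrow> real \<times> real \<Rightarrow> real" where
  "E_hat g1 g2 p = 1 - ((partial_x g1 p)\<^sup>2 + (partial_x g2 p)\<^sup>2)"

definition F_hat :: "(real \<times> real \<Rightarrow> real) \<Rightarrow> (real \<times> real \<Rightarrow> real) \<Rightarrow> real \<times> real \<Rightarrow> real" where
  "F_hat g1 g2 p = - (partial_x g1 p * partial_y g1 p + partial_x g2 p * partial_y g2 p)"

definition G_hat :: "(real \<times> real \<Rightarrow> real) \<Rightarrow> (real \<times> real \<Rightarrow> real) \<Rightarrow> real \<times> real \<Rightarrow> real" where
  "G_hat g1 g2 p = 1 - ((partial_y g1 p)\<^sup>2 + (partial_y g2 p)\<^sup>2)"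

text \<open>These are the coefficients of the metric induced on the graph.\<close>

lemma induced_metric_graph42:
  fixes g1 g2 :: "real \<times> real \<Rightarrow> real" and p :: "real \<times> real"
  defines "X \<equiv> (1, 0, partial_x g1 p, partial_x g2 p)"
    and "Y \<equiv> (0, 1, partial_y g1 p, partial_y g2 p)"
  shows "E_hat g1 g2 p = form42 X X" "F_hat g1 g2 p = form42 X Y" "G_hat g1 g2 p = form42 Y Y"
  by (simp_all add: X_def Y_def form42_def E_hat_def F_hat_def G_hat_def power2_eq_square)

definition spacelike_graph :: "(real \<times> real \<Rightarrow> real) \<Rightarrow> (real \<times> real \<Rightarrow> real) \<Rightarrow> bool" where
  "spacelike_graph g1 g2 \<longleftrightarrow>
     (\<forall>p a b. (a, b) \<noteq> (0, 0) \<longrightarrow>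
        E_hat g1 g2 p * a\<^sup>2 + 2 * F_hat g1 g2 p * a * b + G_hat g1 g2 p * b\<^sup>2 > 0)"

definition zero_mean_curvature_graph ::
  "(real \<times> real \<Rightarrow> real) \<Rightarrow> (real \<times> real \<Rightarrow> real) \<Rightarrow> bool" where
  "zero_mean_curvature_graph g1 g2 \<longleftrightarrow>
     (\<forall>g \<in> {g1, g2}. \<forall>p.
        G_hat g1 g2 p * partial_x (partial_x g) p
        - 2 * F_hat g1 g2 p * partial_y (partial_x g) p
        + E_hat g1 g2 p * partial_y (partial_y g) p = 0)"

text \<open>The \<open>C\<^sup>2\<close> condition makes the derivatives above meaningful; for gradient graphs of
  \<open>C\<^sup>3\<close> functions it holds automatically, see \<open>C_k_partial\<close> below.\<close>

definition maximal_graph :: "(real \<times> real \<Rightarrow> real) \<Rightarrow> (real \<times> real \<Rightarrow> real) \<Rightarrow> bool" where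
  "maximal_graph g1 g2 \<longleftrightarrow>
     C_k 2 g1 \<and> C_k 2 g2 \<and> spacelike_graph g1 g2 \<and> zero_mean_curvature_graph g1 g2"

text \<open>Planes are affine; \<open>p - q\<close> ranges over the direction space of \<open>P\<close>.\<close>

definition spacelike_plane :: "r4 set \<Rightarrow> bool" where
  "spacelike_plane P \<longleftrightarrow>
     affine P \<and> aff_dim P = 2 \<and>
     (\<forall>p \<in> P. \<forall>q \<in> P. p \<noteq> q \<longrightarrow> form42 (p - q) (p - q) > 0)"

lemma partial_eq_frechet_derivative:
  fixes g :: "real \<times> real \<Rightarrow> real"
  assumes "g differentiable (at p)"
  shows "partial_x g p = frechet_derivative g (at p) (1, 0)"
    and "partial_y g p = frechet_derivative g (at p) (0, 1)"
proof -
  obtain x y where p: "p = (x, y)" by (cases p)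
  let ?D = "frechet_derivative g (at (x, y))"
  have D: "(g has_derivative ?D) (at (x, y))"
    using assms frechet_derivative_works p by blast
  interpret D: bounded_linear ?D using D by (rule has_derivative_bounded_linear)
  have "((\<lambda>t. g (t, y)) has_derivative (\<lambda>h. ?D (h, 0))) (at x)"
    by (rule has_derivative_compose[of "\<lambda>t. (t, y)", OF _ D])
       (auto intro!: derivative_eq_intros)
  moreover have "(\<lambda>h. ?D (h, 0)) = (*) (?D (1, 0))"
  proof
    fix h :: real
    show "?D (h, 0) = ?D (1, 0) * h"
      using D.scaleR[of h "(1, 0)"] by simp
  qed
  ultimately show "partial_x g p = frechet_derivative g (at p) (1, 0)"
    unfolding partial_x_def p prod.case
    by (intro DERIV_imp_deriv) (simp add: has_field_derivative_def)
  have "((\<lambda>t. g (x, t)) has_derivative (\<lambda>h. ?D (0, h))) (at y)"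
    by (rule has_derivative_compose[of "\<lambda>t. (x, t)", OF _ D])
       (auto intro!: derivative_eq_intros)
  moreover have "(\<lambda>h. ?D (0, h)) = (*) (?D (0, 1))"
  proof
    fix h :: real
    show "?D (0, h) = ?D (0, 1) * h"
      using D.scaleR[of h "(0, 1)"] by simp
  qed
  ultimately show "partial_y g p = frechet_derivative g (at p) (0, 1)"
    unfolding partial_y_def p prod.case
    by (intro DERIV_imp_deriv) (simp add: has_field_derivative_def)
qed

lemma C_k_partial:
  fixes g :: "real \<times> real \<Rightarrow> real"
  assumes "C_k (Suc k) g"
  shows "C_k k (partial_x g)" "C_k k (partial_y g)"
proof -
  have "partial_x g = (\<lambda>p. frechet_derivative g (at p) (1, 0))"
    "partial_y g = (\<lambda>p. frechet_derivative g (at p) (0, 1))"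
    using assms by (simp_all add: partial_eq_frechet_derivative fun_eq_iff del: split_paired_All)
  then show "C_k k (partial_x g)" "C_k k (partial_y g)"
    using assms by auto
qed

end

theory Submission
  imports Defs "HOL-Complex_Analysis.Complex_Analysis"
begin

text \<open>Let \<open>H\<close> be the Hessian of \<open>f\<close>. Since the induced metric is \<open>I - H\<^sup>2\<close>, the eigenvalues of \<open>H\<close>
  lie in \<open>(-1, 1)\<close>, and the maximal surface equation says that \<open>tr H / (1 + det H)\<close> has zero gradient,
  so this quotient is a constant \<open>C\<close> with \<open>\<bar>C\<bar> < 1\<close>. Write \<open>C = 2 k / (1 + k\<^sup>2)\<close> with \<open>\<bar>k\<bar> < 1\<close>.
  As \<open>grad f\<close> is 1-Lipschitz, \<open>\<phi> = id - k grad f\<close> is a homeomorphism of the plane, and the choice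
  of \<open>k\<close> makes \<open>(H - k) (I - k H)\<^sup>-\<^sup>1\<close>, the derivative of \<open>(grad f - k id) \<circ> \<phi>\<^sup>-\<^sup>1\<close>, symmetric and
  trace-free. The complex conjugate of this map is therefore entire with bounded derivative; by
  Liouville's theorem the derivative is constant, and hence so is \<open>H\<close>.\<close>

section \<open>Partial derivatives and the Frechet derivative\<close>

lemma DERIV_partial:
  fixes g :: "real \<times> real \<Rightarrow> real"
  assumes "g differentiable (at (x, y))"
  shows "((\<lambda>t. g (t, y)) has_real_derivative partial_x g (x, y)) (at x)"
    and "((\<lambda>t. g (x, t)) has_real_derivative partial_y g (x, y)) (at y)"
proof -
  obtain D where D: "(g has_derivative D) (at (x, y))"
    using assms by (auto simp: differentiable_def)
  have "((\<lambda>t. g (t, y)) has_derivative (\<lambda>h. D (h, 0))) (at x)"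
    by (rule has_derivative_compose[of "\<lambda>t. (t, y)", OF _ D])
       (auto intro!: derivative_eq_intros)
  then have "(\<lambda>t. g (t, y)) differentiable at x"
    by (auto simp: differentiable_def)
  then show "((\<lambda>t. g (t, y)) has_real_derivative partial_x g (x, y)) (at x)"
    by (simp add: partial_x_def DERIV_deriv_iff_real_differentiable)
  have "((\<lambda>t. g (x, t)) has_derivative (\<lambda>h. D (0, h))) (at y)"
    by (rule has_derivative_compose[of "\<lambda>t. (x, t)", OF _ D])
       (auto intro!: derivative_eq_intros)
  then have "(\<lambda>t. g (x, t)) differentiable at y"
    by (auto simp: differentiable_def)
  then show "((\<lambda>t. g (x, t)) has_real_derivative partial_y g (x, y)) (at y)"
    by (simp add: partial_y_def DERIV_deriv_iff_real_differentiable)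
qed

lemma has_derivative_partial:
  fixes g :: "real \<times> real \<Rightarrow> real"
  assumes "g differentiable (at p)"
  shows "(g has_derivative (\<lambda>h. partial_x g p * fst h + partial_y g p * snd h)) (at p)"
proof -
  let ?D = "frechet_derivative g (at p)"
  have D: "(g has_derivative ?D) (at p)"
    using assms frechet_derivative_works by blast
  interpret D: bounded_linear ?D using D by (rule has_derivative_bounded_linear)
  have "?D h = partial_x g p * fst h + partial_y g p * snd h" for h
  proof -
    have "h = fst h *\<^sub>R (1, 0) + snd h *\<^sub>R (0, 1)" by (simp add: prod_eq_iff)
    then have "?D h = fst h *\<^sub>R ?D (1, 0) + snd h *\<^sub>R ?D (0, 1)"
      by (metis D.add D.scaleR)
    then show ?thesis
      by (simp add: partial_eq_frechet_derivative[OF assms] mult.commute)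
  qed
  then have "?D = (\<lambda>h. partial_x g p * fst h + partial_y g p * snd h)" ..
  with D show ?thesis by simp
qed

lemma has_derivative_partial_complex:
  fixes g :: "real \<times> real \<Rightarrow> real"
  assumes "g differentiable (at (Re z, Im z))"
  shows "((\<lambda>z. g (Re z, Im z)) has_derivative
    (\<lambda>h. partial_x g (Re z, Im z) * Re h + partial_y g (Re z, Im z) * Im h)) (at z)"
proof -
  have "((\<lambda>z. (Re z, Im z)) has_derivative (\<lambda>h. (Re h, Im h))) (at z)"
    by (auto intro!: derivative_eq_intros)
  from has_derivative_compose[OF this has_derivative_partial[OF assms]]
  show ?thesis by simp
qed

lemma C_k_Suc_differentiable: "C_k (Suc k) g \<Longrightarrow> g differentiable (at p)"
  by simp

lemma C_k_mono_Suc: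
  fixes g :: "'a::euclidean_space \<Rightarrow> 'b::real_normed_vector"
  shows "C_k (Suc k) g \<Longrightarrow> C_k k g"
proof (induction k arbitrary: g)
  case 0
  then show ?case
    by (auto intro!: continuous_at_imp_continuous_on differentiable_imp_continuous_within)
qed auto

section \<open>Symmetry of mixed second derivatives\<close>

text \<open>The second difference of \<open>g\<close> over a square of side \<open>h\<close> is
  \<open>h * h\<close> times either mixed derivative at some interior point, by the mean value
  theorem applied in the two variables in either order. Continuity then lets the square shrink to
  its corner.\<close>

lemma partial_commute:
  fixes g :: "real \<times> real \<Rightarrow> real"
  assumes "C_k 2 g"
  shows "partial_x (partial_y g) = partial_y (partial_x g)"
proof
  fix p :: "real \<times> real"
  have C1: "C_k (Suc 0) (partial_x g)" "C_k (Suc 0) (partial_y g)" and C2: "C_k (Suc (Suc 0)) g"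
    using C_k_partial[of "Suc 0" g] assms by (simp_all only: numeral_2_eq_2)
  note d = C_k_Suc_differentiable[OF C1(1)] C_k_Suc_differentiable[OF C1(2)]
    C_k_Suc_differentiable[OF C2]
  obtain x y where p: "p = (x, y)" by (cases p)
  let ?a = "partial_x (partial_y g)" and ?b = "partial_y (partial_x g)"
  have near: "\<exists>\<xi> \<eta> \<xi>' \<eta>'. {\<xi>, \<xi>'} \<subseteq> {x<..<x+h} \<and> {\<eta>, \<eta>'} \<subseteq> {y<..<y+h} \<and>
      ?b (\<xi>, \<eta>) = ?a (\<xi>', \<eta>')" if h: "h > 0" for h
  proof -
    let ?\<Delta> = "g (x+h, y+h) - g (x+h, y) - (g (x, y+h) - g (x, y))"
    \<comment> \<open>Odd entries differentiate in \<open>x\<close>, even ones in \<open>y\<close>;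
      the three pairs belong to \<open>partial_x g\<close>, \<open>partial_y g\<close> and
      \<open>g\<close>, in this order.\<close>
    note D = DERIV_partial[OF d(1)] DERIV_partial[OF d(2)] DERIV_partial[OF d(3)]
    obtain \<xi> where \<xi>: "x < \<xi>" "\<xi> < x + h"
      and 1: "?\<Delta> = h * (partial_x g (\<xi>, y+h) - partial_x g (\<xi>, y))"
      using MVT2[OF _ DERIV_diff[OF D(5) D(5)], of x "x+h" "y+h" y] h
      by (auto simp: algebra_simps)
    obtain \<eta> where \<eta>: "y < \<eta>" "\<eta> < y + h"
      and 2: "partial_x g (\<xi>, y+h) - partial_x g (\<xi>, y) = h * ?b (\<xi>, \<eta>)"
      using MVT2[OF _ D(2), of y "y+h" \<xi>] h by auto
    obtain \<eta>' where \<eta>': "y < \<eta>'" "\<eta>' < y + h"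
      and 3: "?\<Delta> = h * (partial_y g (x+h, \<eta>') - partial_y g (x, \<eta>'))"
      using MVT2[OF _ DERIV_diff[OF D(6) D(6)], of y "y+h" "x+h" x] h
      by (auto simp: algebra_simps)
    obtain \<xi>' where \<xi>': "x < \<xi>'" "\<xi>' < x + h"
      and 4: "partial_y g (x+h, \<eta>') - partial_y g (x, \<eta>') = h * ?a (\<xi>', \<eta>')"
      using MVT2[OF _ D(3), of x "x+h" \<eta>'] h by auto
    have "?b (\<xi>, \<eta>) = ?a (\<xi>', \<eta>')" using 1 2 3 4 h by simp
    then show ?thesis using \<xi> \<eta> \<xi>' \<eta>' by (intro exI conjI) auto
  qed
  have "continuous_on UNIV ?a" "continuous_on UNIV ?b"
    using C_k_partial(1)[OF C1(2)] C_k_partial(2)[OF C1(1)] by simp_all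
  then have ca: "isCont ?a (x, y)" and cb: "isCont ?b (x, y)"
    by (auto simp: continuous_on_eq_continuous_at)
  show "?a p = ?b p"
  proof (rule ccontr)
    assume ne: "?a p \<noteq> ?b p"
    \<comment> \<open>Half the gap: a common value within \<open>e\<close> of both
      \<open>?a p\<close> and \<open>?b p\<close> would violate the triangle inequality.\<close>
    define e where "e = dist (?a p) (?b p) / 2"
    have e: "e > 0" using ne by (simp add: e_def)
    obtain r where r: "r > 0" "\<And>q. dist q (x, y) < r \<Longrightarrow> dist (?a q) (?a p) < e"
      using ca e unfolding continuous_at_eps_delta p by blast
    obtain s where s: "s > 0" "\<And>q. dist q (x, y) < s \<Longrightarrow> dist (?b q) (?b p) < e"
      using cb e unfolding continuous_at_eps_delta p by blast
    \<comment> \<open>Points of the open square of side \<open>h\<close> lie within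
      \<open>2 * h\<close> of its corner.\<close>
    define h where "h = min r s / 2"
    have h: "h > 0" using r s by (simp add: h_def)
    obtain \<xi> \<eta> \<xi>' \<eta>' where *: "{\<xi>, \<xi>'} \<subseteq> {x<..<x+h}" "{\<eta>, \<eta>'} \<subseteq> {y<..<y+h}"
      "?b (\<xi>, \<eta>) = ?a (\<xi>', \<eta>')" using near[OF h] by blast
    have box: "dist (u, v) (x, y) < min r s" if "x < u" "u < x + h" "y < v" "v < y + h" for u v
    proof -
      have "dist (u, v) (x, y) \<le> dist u x + dist v y"
        unfolding dist_Pair_Pair by (rule sqrt_sum_squares_le_sum) auto
      also have "\<dots> < h + h" using that by (simp add: dist_real_def)
      finally show ?thesis by (simp add: h_def)
    qed
    have "dist (?a (\<xi>', \<eta>')) (?a p) < e" "dist (?b (\<xi>, \<eta>)) (?b p) < e"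
      using r(2)[of "(\<xi>', \<eta>')"] s(2)[of "(\<xi>, \<eta>)"] box[of \<xi>' \<eta>'] box[of \<xi> \<eta>] * by auto
    then show False
      unfolding *(3) e_def using dist_triangle_half_r by blast
  qed
qed

section \<open>Graphs of affine maps\<close>

text \<open>Such a graph is a translate of the image of the plane under an injective linear map,
  which preserves dimension.\<close>

lemma affine_graph42:
  "affine (graph42 (\<lambda>p. a * fst p + b * snd p + c) (\<lambda>p. a' * fst p + b' * snd p + c'))"
  "aff_dim (graph42 (\<lambda>p. a * fst p + b * snd p + c) (\<lambda>p. a' * fst p + b' * snd p + c')) = 2"
proof -
  let ?P = "graph42 (\<lambda>p. a * fst p + b * snd p + c) (\<lambda>p. a' * fst p + b' * snd p + c')"
  let ?L = "\<lambda>p::real \<times> real. (fst p, snd p, a * fst p + b * snd p, a' * fst p + b' * snd p)"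
  have L: "linear ?L"
    by (rule linearI) (simp_all add: algebra_simps)
  have inj: "inj ?L"
    by (rule injI) (simp add: prod_eq_iff)
  have P: "?P = (+) (0, 0, c, c') ` range ?L"
    unfolding graph42_def by (auto simp: image_iff algebra_simps)
  have "subspace (range ?L)"
    using L by (simp add: linear_subspace_image)
  then show "affine ?P"
    unfolding P using affine_translation subspace_imp_affine by blast
  show "aff_dim ?P = 2"
    unfolding P using L inj by (simp add: aff_dim_translation_eq)
qed

section \<open>Perturbing the identity by a contraction\<close>

text \<open>The lower bound is the reverse triangle inequality; it makes the map injective and its
  inverse Lipschitz. A preimage of \<open>y\<close> is a fixed point of
  \<open>\<lambda>x. y + F x\<close>, which Banach's theorem supplies.\<close>

lemma id_minus_contraction:
  fixes F :: "'a::banach \<Rightarrow> 'a"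
  assumes c: "0 \<le> c" "c < 1"
    and F: "\<And>x y. norm (F x - F y) \<le> c * norm (x - y)"
  shows "(1 - c) * norm (x - y) \<le> norm ((x - F x) - (y - F y))"
    and "bij (\<lambda>x. x - F x)"
    and "continuous_on UNIV (inv (\<lambda>x. x - F x))"
proof -
  let ?\<phi> = "\<lambda>x. x - F x"
  show lower: "(1 - c) * norm (x - y) \<le> norm (?\<phi> x - ?\<phi> y)" for x y
  proof -
    have "norm (x - y) - norm (F x - F y) \<le> norm ((x - y) - (F x - F y))"
      by (rule norm_triangle_ineq2)
    with F[of x y] show ?thesis by (simp add: algebra_simps)
  qed
  have "inj ?\<phi>"
  proof (rule injI)
    fix x y assume "?\<phi> x = ?\<phi> y"
    with lower[of x y] have "(1 - c) * norm (x - y) \<le> 0" by simp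
    with c show "x = y" by (simp add: mult_le_0_iff)
  qed
  moreover have "\<exists>x. y = ?\<phi> x" for y
  proof -
    have "\<exists>!x. y + F x = x"
      using c F by (intro banach_fix_type) (auto simp: dist_norm)
    then obtain x where "y + F x = x" by blast
    then have "y = x - F x" by (metis add_diff_cancel_right')
    then show ?thesis ..
  qed
  ultimately show bij: "bij ?\<phi>"
    by (auto simp: bij_def surj_def)
  have "(1 / (1 - c))-lipschitz_on UNIV (inv ?\<phi>)"
  proof (rule lipschitz_onI)
    fix v w
    have eq: "?\<phi> (inv ?\<phi> v) = v" "?\<phi> (inv ?\<phi> w) = w"
      using bij by (simp_all add: bij_is_surj surj_f_inv_f[of ?\<phi>])
    have "(1 - c) * norm (inv ?\<phi> v - inv ?\<phi> w) \<le> norm (v - w)"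
      using lower[of "inv ?\<phi> v" "inv ?\<phi> w"] unfolding eq .
    then show "dist (inv ?\<phi> v) (inv ?\<phi> w) \<le> 1 / (1 - c) * dist v w"
      using c by (simp add: dist_norm field_simps)
  qed (use c in simp)
  then show "continuous_on UNIV (inv ?\<phi>)"
    by (rule lipschitz_on_continuous_on)
qed

section \<open>Liouville's theorem for the transformed gradient\<close>

text \<open>Since \<open>\<mu>\<close> is real, the Jacobian of \<open>u\<close> is symmetric. Its
  eigenvalues are \<open>\<mu>\<close> plus or minus \<open>cmod \<nu>\<close>, so its trace is
  \<open>2 * \<mu>\<close> and its determinant \<open>\<mu>\<^sup>2 - (cmod \<nu>)\<^sup>2\<close>.
  Thus \<open>eq\<close> says that the trace is \<open>2 * k / (1 + k\<^sup>2)\<close> times one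
  plus the determinant.\<close>

lemma constant_Wirtinger_derivatives:
  fixes u \<nu> :: "complex \<Rightarrow> complex" and \<mu> :: "complex \<Rightarrow> real" and k :: real
  assumes du: "\<And>z. (u has_derivative (\<lambda>h. of_real (\<mu> z) * h + \<nu> z * cnj h)) (at z)"
    and small: "\<And>z. \<bar>\<mu> z\<bar> + cmod (\<nu> z) < 1"
    and k: "\<bar>k\<bar> < 1"
    and eq: "\<And>z. (1 + k\<^sup>2) * \<mu> z = k * (1 + (\<mu> z)\<^sup>2 - (cmod (\<nu> z))\<^sup>2)"
  shows "\<mu> z = \<mu> 0" and "\<nu> z = \<nu> 0"
proof -
  define L where "L z h = of_real (\<mu> z) * h + \<nu> z * cnj h" for z h
  have norm_L: "cmod (L z h) \<le> cmod h" for z h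
  proof -
    have "cmod (L z h) \<le> (\<bar>\<mu> z\<bar> + cmod (\<nu> z)) * cmod h"
      unfolding L_def by (rule order.trans[OF norm_triangle_ineq]) (simp add: norm_mult algebra_simps)
    also have "\<dots> \<le> 1 * cmod h"
      using small[of z] by (intro mult_right_mono) auto
    finally show ?thesis by simp
  qed
  have du: "(u has_derivative L z) (at z)" for z
    using du by (simp add: L_def[abs_def])
  have lip: "cmod (u x - u y) \<le> 1 * cmod (x - y)" for x y
    by (rule differentiable_bound[of UNIV u L])
       (use du norm_L in \<open>auto intro!: onorm_bound\<close>)
  define F where "F z = of_real k * u z" for z
  define \<phi> where "\<phi> = (\<lambda>z. z - F z)"
  define \<psi> where "\<psi> = inv \<phi>"
  have "cmod (F x - F y) \<le> \<bar>k\<bar> * cmod (x - y)" for x y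
    using lip[of x y] by (simp add: F_def norm_mult mult_left_mono flip: right_diff_distrib)
  note contr = id_minus_contraction[of "\<bar>k\<bar>" F, OF abs_ge_zero k this]
  have \<phi>\<psi>: "\<phi> (\<psi> w) = w" and \<psi>\<phi>: "\<psi> (\<phi> z) = z" for w z
    using contr(2) by (simp_all add: \<psi>_def \<phi>_def bij_is_surj surj_f_inv_f[of "\<lambda>z. z - F z"]
        inv_f_f[of "\<lambda>z. z - F z"] bij_is_inj)
  have cont_\<psi>: "isCont \<psi> w" for w
    using contr(3) by (simp add: \<psi>_def \<phi>_def continuous_on_eq_continuous_at)
  \<comment> \<open>Comparing the coefficients of \<open>v\<close> in \<open>CR\<close> below forces
    this multiplier; \<open>small\<close> and \<open>k\<close> keep its denominator positive and its
    modulus below 1.\<close>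
  define m where "m z = cnj (\<nu> z) / of_real (1 - k * \<mu> z)" for z
  have k\<mu>: "1 - k * \<mu> z > cmod (\<nu> z)" for z
  proof -
    have "\<bar>k * \<mu> z\<bar> \<le> 1 * \<bar>\<mu> z\<bar>"
      unfolding abs_mult using k by (intro mult_right_mono) auto
    with small[of z] show ?thesis by linarith
  qed
  have k\<mu>0: "1 - k * \<mu> z > 0" for z
    using k\<mu>[of z] norm_ge_zero[of "\<nu> z"] by linarith
  have m_less: "cmod (m z) < 1" for z
    unfolding m_def norm_divide norm_of_real complex_mod_cnj using k\<mu>[of z] k\<mu>0[of z] by simp
  \<comment> \<open>The hypothesis on \<open>\<mu>\<close> and \<open>\<nu>\<close> is precisely the Cauchy-Riemann equation here.\<close>
  have CR: "cnj (L z v - of_real k * v) = m z * (v - of_real k * L z v)" for z v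
  proof -
    have nz: "complex_of_real (1 - k * \<mu> z) \<noteq> 0"
      using k\<mu>0[of z] by (simp only: of_real_eq_0_iff)
    have m: "m z * of_real (1 - k * \<mu> z) = cnj (\<nu> z)"
      using nz by (simp add: m_def)
    \<comment> \<open>This is \<open>eq\<close> factored; it settles the coefficient of
      \<open>cnj v\<close>.\<close>
    have "(\<mu> z - k) * (1 - k * \<mu> z) = - k * (cmod (\<nu> z))\<^sup>2"
      using eq[of z] by (simp add: algebra_simps power2_eq_square)
    then have "of_real (\<mu> z - k) * of_real (1 - k * \<mu> z) = - of_real k * (\<nu> z * cnj (\<nu> z))"
      unfolding complex_norm_square[symmetric] by (metis of_real_minus of_real_mult)
    then have "of_real (\<mu> z - k) * of_real (1 - k * \<mu> z)
        = (- of_real k * \<nu> z * m z) * of_real (1 - k * \<mu> z)"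
      unfolding m[symmetric] by (simp only: ac_simps)
    then have \<mu>: "of_real (\<mu> z - k) = - of_real k * \<nu> z * m z"
      using nz by (simp only: mult_cancel_right) simp
    have "cnj (L z v - of_real k * v) = of_real (\<mu> z - k) * cnj v + cnj (\<nu> z) * v"
      by (simp add: L_def algebra_simps)
    also have "\<dots> = m z * (v - of_real k * L z v)"
      unfolding \<mu> m[symmetric] by (simp add: L_def algebra_simps)
    finally show ?thesis .
  qed
  define W where "W w = cnj (u (\<psi> w) - of_real k * \<psi> w)" for w
  have dW: "(W has_field_derivative m (\<psi> w)) (at w)" for w
  proof -
    let ?z = "\<psi> w"
    let ?D = "\<lambda>h. h - of_real k * L ?z h"
    have d\<phi>: "(\<phi> has_derivative ?D) (at ?z)"
      unfolding \<phi>_def F_def by (rule has_derivative_diff[OF has_derivative_ident has_derivative_mult_right[OF du]])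
    then have lin: "linear ?D" by (rule has_derivative_linear)
    have "inj ?D"
    proof (rule linear_injective_0[THEN iffD2, OF lin, rule_format])
      fix h assume "?D h = 0"
      then have "h = of_real k * L ?z h" by simp
      then have "cmod h \<le> \<bar>k\<bar> * cmod h"
        by (metis abs_ge_zero mult_left_mono norm_L norm_mult norm_of_real)
      then have "(1 - \<bar>k\<bar>) * cmod h \<le> 0" by (simp add: algebra_simps)
      with k show "h = 0" by (simp add: mult_le_0_iff)
    qed
    then obtain g' where g': "linear g'" "g' \<circ> ?D = id"
      using linear_injective_left_inverse[OF lin] by blast
    have right: "?D (g' h) = h" for h
      using linear_inverse_left[OF lin g'(1)] g'(2) by (metis comp_apply id_apply)
    \<comment> \<open>Because \<open>\<psi>\<close> is already known to be continuous, a linear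
      inverse of the derivative of \<open>\<phi>\<close> yields differentiability of
      \<open>\<psi>\<close>.\<close>
    have d\<psi>: "(\<psi> has_derivative g') (at w)"
      by (rule has_derivative_inverse_basic[OF d\<phi> _ g'(2) cont_\<psi> open_UNIV UNIV_I \<phi>\<psi>])
         (use g'(1) linear_conv_bounded_linear in blast)
    have "(W has_derivative (\<lambda>h. cnj (L ?z (g' h) - of_real k * g' h))) (at w)"
      unfolding W_def
      by (rule has_derivative_cnj[OF has_derivative_diff[OF has_derivative_compose[OF d\<psi> du]
              has_derivative_mult_right[OF d\<psi>]]])
    \<comment> \<open>With \<open>v = g' h\<close> in \<open>CR\<close>, the factor next to
      \<open>m ?z\<close> becomes \<open>h\<close>, so the derivative of \<open>W\<close> is complex
      linear.\<close>
    moreover have "(\<lambda>h. cnj (L ?z (g' h) - of_real k * g' h)) = (*) (m ?z)"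
      unfolding CR right ..
    ultimately show ?thesis by (simp add: has_field_derivative_def)
  qed
  have "W holomorphic_on UNIV"
    using dW by (auto simp: holomorphic_on_def field_differentiable_def)
  then have "deriv W holomorphic_on UNIV"
    by (rule holomorphic_deriv) simp
  moreover have W': "deriv W w = m (\<psi> w)" for w
    using dW by (rule DERIV_imp_deriv)
  moreover have "bounded (range (deriv W))"
    unfolding bounded_iff using m_less by (auto simp: W' intro!: exI[of _ 1] less_imp_le)
  ultimately have "deriv W constant_on UNIV"
    by (intro Liouville_theorem)
  then obtain C where "\<And>w. deriv W w = C" by (auto simp: constant_on_def)
  then have m_const: "m z = C" for z
    using W' \<psi>\<phi> by metis
  \<comment> \<open>It remains to recover \<open>\<mu>\<close> and \<open>\<nu>\<close> from the
    constant \<open>C\<close>. Substituting \<open>\<nu> = cnj C * (1 - k * \<mu>)\<close> into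
    \<open>eq\<close> and cancelling the positive factor \<open>1 - k * \<mu>\<close> leaves a
    linear equation for \<open>\<mu>\<close> with leading coefficient
    \<open>1 - k\<^sup>2 * M\<close>.\<close>
  define M where "M = (cmod C)\<^sup>2"
  have M: "0 \<le> M" "M < 1"
    using m_less[of 0] by (simp_all add: M_def m_const abs_square_less_1)
  have k2M: "1 - k\<^sup>2 * M > 0"
  proof -
    have "k\<^sup>2 * M \<le> 1 * M" using k M by (intro mult_right_mono) (auto simp: abs_square_le_1)
    with M show ?thesis by simp
  qed
  have \<nu>: "\<nu> z = cnj C * of_real (1 - k * \<mu> z)" for z
  proof -
    have "complex_of_real (1 - k * \<mu> z) \<noteq> 0"
      using k\<mu>0[of z] by (simp only: of_real_eq_0_iff)
    then have "C * of_real (1 - k * \<mu> z) = cnj (\<nu> z)"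
      using nonzero_eq_divide_eq m_const[of z] unfolding m_def by metis
    then have "cnj (C * of_real (1 - k * \<mu> z)) = \<nu> z"
      by (simp only: complex_cnj_cnj)
    then show ?thesis by simp
  qed
  have \<mu>: "\<mu> z = k * (1 - M) / (1 - k\<^sup>2 * M)" for z
  proof -
    have "(cmod (\<nu> z))\<^sup>2 = M * (1 - k * \<mu> z)\<^sup>2"
      unfolding \<nu>[of z] by (simp only: norm_mult complex_mod_cnj norm_of_real power_mult_distrib
          power2_abs M_def)
    moreover have "(1 - k * \<mu> z) * (\<mu> z - k) = - k * (cmod (\<nu> z))\<^sup>2"
      using eq[of z] by (simp add: algebra_simps power2_eq_square)
    ultimately have "(1 - k * \<mu> z) * (\<mu> z - k) = (1 - k * \<mu> z) * (- k * M * (1 - k * \<mu> z))"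
      by (simp add: power2_eq_square)
    then have "\<mu> z - k = - k * M * (1 - k * \<mu> z)"
      using k\<mu>0[of z] by (metis mult_left_cancel less_irrefl)
    then have "\<mu> z * (1 - k\<^sup>2 * M) = k * (1 - M)"
      by (simp add: algebra_simps power2_eq_square)
    with k2M show ?thesis by (simp add: eq_divide_eq)
  qed
  show "\<mu> z = \<mu> 0" using \<mu>[of z] \<mu>[of 0] by simp
  then show "\<nu> z = \<nu> 0" using \<nu>[of z] \<nu>[of 0] by simp
qed

section \<open>Hessian eigenvalues and the hyperbolic half angle\<close>

text \<open>For the symmetric matrix \<open>H\<close> with entries \<open>a\<close>,
  \<open>b\<close>, \<open>d\<close>, the form belongs to \<open>I - H\<^sup>2\<close>, whose
  determinant is \<open>det (I - H) * det (I + H)\<close>, that is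
  \<open>(1 + det H)\<^sup>2 - (tr H)\<^sup>2\<close>. The second bound concerns the largest
  absolute eigenvalue: the modulus is half the gap between the eigenvalues.\<close>

lemma spacelike_gradient_eigenvalue_bounds:
  fixes a b d :: real
  assumes pos: "\<And>v w. (v, w) \<noteq> (0, 0) \<Longrightarrow>
    (1 - (a\<^sup>2 + b\<^sup>2)) * v\<^sup>2 + 2 * - (a * b + b * d) * v * w + (1 - (b\<^sup>2 + d\<^sup>2)) * w\<^sup>2 > 0"
  shows "\<bar>a + d\<bar> < 1 + (a * d - b\<^sup>2)"
    and "\<bar>(a + d) / 2\<bar> + cmod (Complex ((a - d) / 2) b) < 1"
proof -
  define E F G where "E = 1 - (a\<^sup>2 + b\<^sup>2)" and "F = - (a * b + b * d)" and "G = 1 - (b\<^sup>2 + d\<^sup>2)"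
  note defs = E_def F_def G_def
  note pos' = pos[folded defs]
  have E: "E > 0" using pos'[of 1 0] by simp
  have G: "G > 0" using pos'[of 0 1] by simp
  \<comment> \<open>At \<open>(F, - E)\<close> the form takes the value \<open>E\<close> times its
    determinant.\<close>
  have "E * F\<^sup>2 + 2 * F * F * (- E) + G * (- E)\<^sup>2 > 0" using pos'[of F "- E"] E by simp
  then have "E * (E * G - F\<^sup>2) > 0" by (simp add: algebra_simps power2_eq_square)
  with E have "E * G - F\<^sup>2 > 0" by (simp add: zero_less_mult_iff)
  also have "E * G - F\<^sup>2 = (1 + (a * d - b\<^sup>2))\<^sup>2 - (a + d)\<^sup>2"
    by (simp add: defs algebra_simps power2_eq_square)
  finally have sq: "(a + d)\<^sup>2 < (1 + (a * d - b\<^sup>2))\<^sup>2" by simp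
  \<comment> \<open>The sign needed for taking square roots:
    \<open>2 * (1 + (a * d - b\<^sup>2))\<close> equals
    \<open>E + G + (a + d)\<^sup>2\<close>.\<close>
  have "0 \<le> (a + d)\<^sup>2" by simp
  then have "1 + (a * d - b\<^sup>2) > 0"
    using E G by (simp add: defs power2_sum)
  with sq show trace: "\<bar>a + d\<bar> < 1 + (a * d - b\<^sup>2)"
    by (intro power2_less_imp_less[of "\<bar>a + d\<bar>"]) simp_all
  define \<mu> where "\<mu> = (a + d) / 2"
  have "a\<^sup>2 < 1\<^sup>2" "d\<^sup>2 < 1\<^sup>2"
    using E G zero_le_power2[of b] unfolding defs one_power2 by linarith+
  then have "\<bar>a\<bar> < 1" "\<bar>d\<bar> < 1" by (simp_all add: abs_square_less_1)
  then have \<mu>: "\<bar>\<mu>\<bar> < 1" by (simp add: \<mu>_def)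
  have "(cmod (Complex ((a - d) / 2) b))\<^sup>2 = \<mu>\<^sup>2 - (a * d - b\<^sup>2)"
    unfolding cmod_power2 \<mu>_def by (simp add: field_simps power2_eq_square)
  also have "\<dots> < \<bar>\<mu>\<bar>\<^sup>2 + 1 - 2 * \<bar>\<mu>\<bar>" 
  proof -
    have "2 * \<bar>\<mu>\<bar> = \<bar>a + d\<bar>" by (simp add: \<mu>_def)
    with trace show ?thesis by simp
  qed
  also have "\<dots> = (1 - \<bar>\<mu>\<bar>)\<^sup>2" by (simp add: power2_diff)
  finally have "cmod (Complex ((a - d) / 2) b) < 1 - \<bar>\<mu>\<bar>"
    by (rule power2_less_imp_less) (use \<mu> in simp)
  then show "\<bar>(a + d) / 2\<bar> + cmod (Complex ((a - d) / 2) b) < 1"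
    by (simp add: \<mu>_def)
qed

text \<open>If \<open>C = tanh t\<close>, then \<open>k = tanh (t / 2)\<close>; in the proof
  \<open>s\<close> is \<open>1 / cosh t\<close>, and \<open>k\<close> is
  \<open>sinh t / (1 + cosh t)\<close>.\<close>

lemma half_angle_parameter:
  fixes C :: real
  assumes "\<bar>C\<bar> < 1"
  obtains k where "\<bar>k\<bar> < 1" "C * (1 + k\<^sup>2) = 2 * k"
proof -
  define s where "s = sqrt (1 - C\<^sup>2)"
  define k where "k = C / (1 + s)"
  have "C\<^sup>2 < 1" using assms by (simp add: abs_square_less_1)
  then have s: "s > 0" "s\<^sup>2 = 1 - C\<^sup>2" by (simp_all add: s_def)
  have k: "\<bar>k\<bar> < 1" using s assms by (simp add: k_def abs_divide)
  have C: "k * (1 + s) = C" using s(1) by (simp add: k_def)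
  have "C * k * (1 + s) = C * C" by (simp only: mult.assoc C)
  also have "\<dots> = (1 - s) * (1 + s)"
    using s(2) by (simp add: algebra_simps power2_eq_square)
  finally have Ck: "C * k = 1 - s"
    using s(1) by (simp only: mult_cancel_right) simp
  have "C * (1 + k\<^sup>2) = C + (C * k) * k" by (simp add: algebra_simps power2_eq_square)
  also have "\<dots> = k * (1 + s) + (1 - s) * k" by (simp only: Ck C)
  also have "\<dots> = 2 * k" by (simp add: algebra_simps)
  finally show thesis using k that by blast
qed

theorem theorem19:
  fixes f :: "real \<times> real \<Rightarrow> real"
  assumes "C_k 3 f"
    and "maximal_graph (partial_x f) (partial_y f)"
  shows "spacelike_plane (graph42 (partial_x f) (partial_y f))"
proof -
  let ?p = "partial_x f" and ?q = "partial_y f"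

  \<comment> \<open>The Hessian and the maximal surface equations\<close>
  define a b d where "a = partial_x ?p" and "b = partial_y ?p" and "d = partial_y ?q"
  have f2: "C_k 2 f"
    using assms(1) C_k_mono_Suc[of 2 f] by (simp only: numeral_3_eq_3 numeral_2_eq_2)
  have p2: "C_k 2 ?p" and q2: "C_k 2 ?q"
    and space: "spacelike_graph ?p ?q" and zmc: "zero_mean_curvature_graph ?p ?q"
    using assms(2) by (simp_all only: maximal_graph_def)
  have qx: "partial_x ?q = b"
    using partial_commute[OF f2] by (simp add: b_def)
  have bx: "partial_x b = partial_y a" and dx: "partial_x d = partial_y b"
    using partial_commute[OF p2] partial_commute[OF q2] by (simp_all add: a_def b_def d_def qx[unfolded b_def])
  have diff1: "?p differentiable (at z)" "?q differentiable (at z)" for z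
    using p2 q2 C_k_Suc_differentiable[of 1] by (simp_all only: numeral_2_eq_2 One_nat_def)
  have "C_k (Suc 0) a" "C_k (Suc 0) b" "C_k (Suc 0) d"
    using C_k_partial[of "Suc 0"] p2 q2 unfolding a_def b_def d_def numeral_2_eq_2 by blast+
  note diff2 = this[THEN C_k_Suc_differentiable]
  have EFG: "E_hat ?p ?q z = 1 - ((a z)\<^sup>2 + (b z)\<^sup>2)"
      "F_hat ?p ?q z = - (a z * b z + b z * d z)"
      "G_hat ?p ?q z = 1 - ((b z)\<^sup>2 + (d z)\<^sup>2)" for z
    by (simp_all add: E_hat_def F_hat_def G_hat_def qx a_def[symmetric] b_def[symmetric] d_def[symmetric])
  have bounds: "\<bar>a z + d z\<bar> < 1 + (a z * d z - (b z)\<^sup>2)"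
      "\<bar>(a z + d z) / 2\<bar> + cmod (Complex ((a z - d z) / 2) (b z)) < 1" for z
    using spacelike_gradient_eigenvalue_bounds[of "a z" "b z" "d z"] space
    unfolding spacelike_graph_def EFG by blast+
  \<comment> \<open>Symmetry of the third derivatives of \<open>f\<close> leaves only
    \<open>x\<close>-derivatives of the Hessian entries in the equation for \<open>?p\<close>, and
    only \<open>y\<close>-derivatives in the one for \<open>?q\<close>.\<close>
  have mc: "(1 - ((b z)\<^sup>2 + (d z)\<^sup>2)) * partial_x a z + 2 * (a z * b z + b z * d z) * partial_x b z
        + (1 - ((a z)\<^sup>2 + (b z)\<^sup>2)) * partial_x d z = 0"
      "(1 - ((b z)\<^sup>2 + (d z)\<^sup>2)) * partial_y a z + 2 * (a z * b z + b z * d z) * partial_y b z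
        + (1 - ((a z)\<^sup>2 + (b z)\<^sup>2)) * partial_y d z = 0" for z
  proof -
    have "G_hat ?p ?q z * partial_x (partial_x g) z - 2 * F_hat ?p ?q z * partial_y (partial_x g) z
        + E_hat ?p ?q z * partial_y (partial_y g) z = 0" if "g \<in> {?p, ?q}" for g
      using zmc that unfolding zero_mean_curvature_graph_def by blast
    from this[of ?p] this[of ?q] show
      "(1 - ((b z)\<^sup>2 + (d z)\<^sup>2)) * partial_x a z + 2 * (a z * b z + b z * d z) * partial_x b z
        + (1 - ((a z)\<^sup>2 + (b z)\<^sup>2)) * partial_x d z = 0"
      "(1 - ((b z)\<^sup>2 + (d z)\<^sup>2)) * partial_y a z + 2 * (a z * b z + b z * d z) * partial_y b z
        + (1 - ((a z)\<^sup>2 + (b z)\<^sup>2)) * partial_y d z = 0"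
      unfolding EFG by (simp_all add: qx a_def[symmetric] b_def[symmetric] d_def[symmetric] bx dx
          algebra_simps)
  qed

  \<comment> \<open>Constancy of the trace quotient\<close>
  define den where "den z = 1 + (a z * d z - (b z)\<^sup>2)" for z
  define Q where "Q z = (a z + d z) / den z" for z
  have den: "den z > 0" for z
    using bounds(1)[of z] unfolding den_def by linarith
  \<comment> \<open>With eigenvalues \<open>tanh \<alpha>\<close> and \<open>tanh \<beta>\<close> of the Hessian, \<open>Q = tanh (\<alpha> + \<beta>)\<close>.\<close>
  have "(Q has_derivative (\<lambda>h. 0)) (at z)" for z
  proof -
    let ?A = "\<lambda>h. partial_x a z * fst h + partial_y a z * snd h"
    let ?B = "\<lambda>h. partial_x b z * fst h + partial_y b z * snd h"
    let ?D = "\<lambda>h. partial_x d z * fst h + partial_y d z * snd h"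
    note D = diff2[of z, THEN has_derivative_partial]
    have "(den has_derivative (\<lambda>h. ?A h * d z + a z * ?D h - 2 * b z * ?B h)) (at z)"
      unfolding den_def power2_eq_square
      by (rule has_derivative_eq_rhs, (rule derivative_intros D)+) (auto simp: algebra_simps)
    from has_derivative_divide[OF has_derivative_add[OF D(1) D(3)] this]
    have "(Q has_derivative (\<lambda>h. - (a z + d z) * (inverse (den z) *
        (?A h * d z + a z * ?D h - 2 * b z * ?B h) * inverse (den z)) + (?A h + ?D h) / den z)) (at z)"
      using den[of z] by (simp add: Q_def[abs_def])
    moreover have "- (a z + d z) * (inverse (den z) *
        (?A h * d z + a z * ?D h - 2 * b z * ?B h) * inverse (den z)) + (?A h + ?D h) / den z = 0" for h
    proof -
      \<comment> \<open>The numerator of the quotient rule has the two expressions in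
        \<open>mc\<close> as its \<open>x\<close> and \<open>y\<close> components.\<close>
      have "(?A h + ?D h) * den z - (a z + d z) * (?A h * d z + a z * ?D h - 2 * b z * ?B h)
          = ((1 - ((b z)\<^sup>2 + (d z)\<^sup>2)) * partial_x a z + 2 * (a z * b z + b z * d z) * partial_x b z
              + (1 - ((a z)\<^sup>2 + (b z)\<^sup>2)) * partial_x d z) * fst h
          + ((1 - ((b z)\<^sup>2 + (d z)\<^sup>2)) * partial_y a z + 2 * (a z * b z + b z * d z) * partial_y b z
              + (1 - ((a z)\<^sup>2 + (b z)\<^sup>2)) * partial_y d z) * snd h"
        unfolding den_def by algebra
      also have "\<dots> = 0" by (simp only: mc)
      finally have num: "(?A h + ?D h) * den z
          - (a z + d z) * (?A h * d z + a z * ?D h - 2 * b z * ?B h) = 0" .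
      have "- s * (inverse n * X * inverse n) + Y / n = (Y * n - s * X) / n\<^sup>2" if "n > 0"
        for s n X Y :: real
        using that by (simp add: field_simps power2_eq_square)
      from this[OF den] show ?thesis by (simp only: num div_0)
    qed
    ultimately show ?thesis by simp
  qed
  then obtain C where Q: "Q z = C" for z
    using has_derivative_zero_constant[of UNIV Q] by auto
  have trace: "a z + d z = C * den z" for z
    using Q[of z] den[of z] by (simp add: Q_def field_simps)
  \<comment> \<open>The trace bound at a single point already controls the constant.\<close>
  have "\<bar>C\<bar> * den 0 < 1 * den 0"
    using bounds(1)[of 0] den[of 0] trace[of 0] by (simp add: den_def[symmetric] abs_mult)
  then have "\<bar>C\<bar> < 1" using den[of 0] by (simp only: mult_less_cancel_right)
  then obtain k where k: "\<bar>k\<bar> < 1" "C * (1 + k\<^sup>2) = 2 * k"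
    by (rule half_angle_parameter)

  \<comment> \<open>The gradient in complex notation\<close>
  define r where "r z = (Re z, Im z)" for z
  define u where "u z = Complex (?p (r z)) (?q (r z))" for z
  \<comment> \<open>Splitting the Hessian into its multiple of the identity and its trace-free part
    gives \<open>\<mu>\<close> and \<open>\<nu>\<close>: a symmetric trace-free matrix acts as
    \<open>h \<mapsto> \<nu> * cnj h\<close>.\<close>
  define \<mu> where "\<mu> z = (a (r z) + d (r z)) / 2" for z
  define \<nu> where "\<nu> z = Complex ((a (r z) - d (r z)) / 2) (b (r z))" for z
  have dp: "((\<lambda>z. ?p (r z)) has_derivative (\<lambda>h. a (r z) * Re h + b (r z) * Im h)) (at z)"
    and dq: "((\<lambda>z. ?q (r z)) has_derivative (\<lambda>h. b (r z) * Re h + d (r z) * Im h)) (at z)" for z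
    using has_derivative_partial_complex[OF diff1(1)] has_derivative_partial_complex[OF diff1(2)]
    by (simp_all add: r_def a_def b_def d_def qx[unfolded b_def])
  have du: "(u has_derivative (\<lambda>h. of_real (\<mu> z) * h + \<nu> z * cnj h)) (at z)" for z
  proof -
    have "(u has_derivative (\<lambda>h. Complex (a (r z) * Re h + b (r z) * Im h)
        (b (r z) * Re h + d (r z) * Im h))) (at z)"
      unfolding u_def Complex_eq by (intro derivative_intros dp dq)
    moreover have "Complex (a (r z) * Re h + b (r z) * Im h) (b (r z) * Re h + d (r z) * Im h)
        = of_real (\<mu> z) * h + \<nu> z * cnj h" for h
      by (simp add: complex_eq_iff \<mu>_def \<nu>_def field_simps)
    ultimately show ?thesis by simp
  qed
  have small: "\<bar>\<mu> z\<bar> + cmod (\<nu> z) < 1" for z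
    using bounds(2) by (simp add: \<mu>_def \<nu>_def)
  \<comment> \<open>This is \<open>trace\<close> multiplied by \<open>(1 + k\<^sup>2) / 2\<close>,
    with \<open>den\<close> rewritten through \<open>\<mu>\<close> and \<open>\<nu>\<close>.\<close>
  have eq: "(1 + k\<^sup>2) * \<mu> z = k * (1 + (\<mu> z)\<^sup>2 - (cmod (\<nu> z))\<^sup>2)" for z
  proof -
    have "(\<mu> z)\<^sup>2 - (cmod (\<nu> z))\<^sup>2 = a (r z) * d (r z) - (b (r z))\<^sup>2"
      unfolding cmod_power2 \<mu>_def \<nu>_def by (simp add: field_simps power2_eq_square)
    then have "1 + (\<mu> z)\<^sup>2 - (cmod (\<nu> z))\<^sup>2 = den (r z)" by (simp add: den_def)
    moreover have "2 * ((1 + k\<^sup>2) * \<mu> z) = C * (1 + k\<^sup>2) * den (r z)"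
      using trace[of "r z"] by (simp add: \<mu>_def)
    ultimately show ?thesis unfolding k(2) by simp
  qed
  note const = constant_Wirtinger_derivatives[OF du small k(1) eq]

  \<comment> \<open>From a constant Hessian to a spacelike plane\<close>
  define a0 b0 d0 where "a0 = a 0" and "b0 = b 0" and "d0 = d 0"
  have Hess: "a z = a0" "b z = b0" "d z = d0" for z
  proof -
    have z: "r (Complex (fst z) (snd z)) = z" "r 0 = 0" by (simp_all add: r_def zero_prod_def)
    have "a z + d z = a0 + d0"
      using const(1)[of "Complex (fst z) (snd z)"] by (simp add: \<mu>_def z a0_def d0_def)
    moreover have "a z - d z = a0 - d0" "b z = b0"
      using const(2)[of "Complex (fst z) (snd z)"] by (simp_all add: \<nu>_def z a0_def b0_def d0_def)
    ultimately show "a z = a0" "b z = b0" "d z = d0" by linarith+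
  qed
  have affine_if: "\<exists>c. g = (\<lambda>z. m * fst z + n * snd z + c)"
    if g: "\<And>z. g differentiable (at z)" and mn: "\<And>z. partial_x g z = m" "\<And>z. partial_y g z = n"
    for g m n
  proof -
    have "((\<lambda>z. g z - (m * fst z + n * snd z)) has_derivative (\<lambda>h. 0)) (at z)" for z
      by (rule has_derivative_eq_rhs, (rule derivative_intros has_derivative_partial[OF g])+)
         (simp add: mn)
    then obtain c where "g z - (m * fst z + n * snd z) = c" for z
      using has_derivative_zero_constant[of UNIV "\<lambda>z. g z - (m * fst z + n * snd z)"] by auto
    then have "g = (\<lambda>z. m * fst z + n * snd z + c)" by (simp add: fun_eq_iff diff_eq_eq add.commute)
    then show ?thesis ..
  qed
  obtain c where p: "?p = (\<lambda>z. a0 * fst z + b0 * snd z + c)"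
    using affine_if[of ?p, OF diff1(1)] Hess by (metis a_def b_def)
  obtain c' where q: "?q = (\<lambda>z. b0 * fst z + d0 * snd z + c')"
    using affine_if[of ?q, OF diff1(2)] Hess by (metis qx d_def)
  have "form42 (P - P') (P - P') > 0"
    if PP': "P \<in> graph42 ?p ?q" "P' \<in> graph42 ?p ?q" "P \<noteq> P'" for P P'
  proof -
    obtain x y x' y' where P: "P = (x, y, ?p (x, y), ?q (x, y))" "P' = (x', y', ?p (x', y'), ?q (x', y'))"
      using PP' by (auto simp: graph42_def)
    with PP'(3) have "(x - x', y - y') \<noteq> (0, 0)" by auto
    \<comment> \<open>As \<open>?p\<close> and \<open>?q\<close> are affine, \<open>P - P'\<close>
      is a tangent vector, so \<open>form42\<close> of it with itself is the induced metric on the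
      difference of the base points.\<close>
    then have "(1 - (a0\<^sup>2 + b0\<^sup>2)) * (x - x')\<^sup>2 + 2 * - (a0 * b0 + b0 * d0) * (x - x') * (y - y')
        + (1 - (b0\<^sup>2 + d0\<^sup>2)) * (y - y')\<^sup>2 > 0"
      using space unfolding spacelike_graph_def EFG Hess by blast
    then show ?thesis
      unfolding P p q by (simp add: form42_def algebra_simps power2_eq_square)
  qed
  then show ?thesis
    unfolding spacelike_plane_def using affine_graph42 unfolding p q by blast
qed

end
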